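(* Let $\mathcal{F}$ be a real Hilbert space and let $\Phi:\mathcal{F}\to(-\infty,\infty]$ be a Legendre-type generator that is twice continuously Fréchet differentiable on $\mathcal{A}=\operatorname{int}(\operatorname{dom}\Phi)$. Let $d_\Phi$ be the functional Bregman divergence generated by $\Phi$. Then the following are equivalent: 1. $d_\Phi(f,g)=d_\Phi(g,f)$ for all $f,g\in\mathcal{A}$. 2. There exist a bounded self-adjoint strictly positive operator $T:\mathcal{F}\to\mathcal{F}$, $b\in\mathcal{F}$ and $c\in\mathbb{R}$ such that $$\Phi(f)=\tfrac12\langle f,Tf\rangle_{\mathcal{F}}+\langle b,f\rangle_{\mathcal{F}}+c,\qquad f\in\mathcal{A}.$$ 3. There exists a bounded self-adjoint strictly positive operator $T:\mathcal{F}\to\mathcal{F}$ such that $$d_\Phi(f,g)=\tfrac12\langle f-g,T(f-g)\rangle_{\mathcal{F}},\qquad f,g\in\mathcal{A}.$$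
   Context: A function $\Phi:\mathcal{F}\to(-\infty,\infty]$ on a real Hilbert space $\mathcal{F}$ is called a generator if it is proper, lower semicontinuous, strictly convex, and Fréchet differentiable on $\mathcal{A}=\operatorname{int}(\operatorname{dom}\Phi)\neq\emptyset$. The Fréchet gradient $\nabla\Phi(g)\in\mathcal{F}$ is the Riesz representer of the Fréchet derivative. The functional Bregman divergence generated by $\Phi$ is, for $f,g\in\mathcal{A}$, $d_\Phi(f,g)=\Phi(f)-\Phi(g)-\langle\nabla\Phi(g),f-g\rangle_{\mathcal{F}}$. A generator is of Legendre type if it is additionally essentially smooth ($\partial\Phi$ is locally bounded and single-valued on its domain) and essentially strictly convex ($(\partial\Phi)^{-1}$ is locally bounded on its domain and $\Phi$ is strictly convex on every convex subset of $\operatorname{dom}\partial\Phi$). Strictly positive means $\langle h,Th\rangle_{\mathcal{F}}>0$ for all $h\neq 0$. *)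

theory Defs
  imports "HOL-Analysis.Analysis"
begin

section \<open>Extended-real-valued functions\<close>

definition eff_dom :: "('a \<Rightarrow> ereal) \<Rightarrow> 'a set" where
  "eff_dom \<Phi> = {x. \<Phi> x < \<infinity>}"

text \<open>The codomain \<open>(-\<infinity>, \<infinity>]\<close> is encoded by the first conjunct.\<close>

definition proper :: "('a \<Rightarrow> ereal) \<Rightarrow> bool" where
  "proper \<Phi> \<longleftrightarrow> (\<forall>x. \<Phi> x \<noteq> - \<infinity>) \<and> eff_dom \<Phi> \<noteq> {}"

definition lower_semicont :: "('a::topological_space \<Rightarrow> ereal) \<Rightarrow> bool" where
  "lower_semicont \<Phi> \<longleftrightarrow> (\<forall>x. \<Phi> x \<le> Liminf (at x) \<Phi>)"

text \<open>Only meaningful for sets \<open>C\<close> contained in the effective domain. For \<open>C = eff_dom \<Phi>\<close>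
  the strict inequality makes the right-hand side, hence the left-hand side, less than \<open>\<infinity>\<close>,
  so it forces the effective domain to be convex.\<close>

definition strictly_convex_on :: "'a::real_vector set \<Rightarrow> ('a \<Rightarrow> ereal) \<Rightarrow> bool" where
  "strictly_convex_on C \<Phi> \<longleftrightarrow>
    (\<forall>x\<in>C. \<forall>y\<in>C. x \<noteq> y \<longrightarrow> (\<forall>t. 0 < t \<and> t < 1 \<longrightarrow>
      \<Phi> ((1 - t) *\<^sub>R x + t *\<^sub>R y) < ereal (1 - t) * \<Phi> x + ereal t * \<Phi> y))"

section \<open>Set-valued maps and the subdifferential\<close>

definition set_valued_dom :: "('a \<Rightarrow> 'b set) \<Rightarrow> 'a set" where
  "set_valued_dom M = {x. M x \<noteq> {}}"

definition set_valued_inverse :: "('a \<Rightarrow> 'b set) \<Rightarrow> 'b \<Rightarrow> 'a set" where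
  "set_valued_inverse M u = {x. u \<in> M x}"

definition single_valued_on_dom :: "('a \<Rightarrow> 'b set) \<Rightarrow> bool" where
  "single_valued_on_dom M \<longleftrightarrow> (\<forall>x\<in>set_valued_dom M. \<exists>!u. u \<in> M x)"

definition locally_bounded_on_dom ::
    "('a::topological_space \<Rightarrow> 'b::metric_space set) \<Rightarrow> bool" where
  "locally_bounded_on_dom M \<longleftrightarrow>
    (\<forall>x\<in>set_valued_dom M. \<exists>U. open U \<and> x \<in> U \<and> bounded (\<Union>y\<in>U. M y))"

text \<open>For proper \<open>\<Phi>\<close> this is automatically empty outside the effective domain.\<close>

definition subdifferential :: "('a::real_inner \<Rightarrow> ereal) \<Rightarrow> 'a \<Rightarrow> 'a set" where
  "subdifferential \<Phi> x = {u. \<forall>y. \<Phi> x + ereal (u \<bullet> (y - x)) \<le> \<Phi> y}"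

section \<open>Generators and the Bregman divergence\<close>

text \<open>Near a point of the interior of its effective domain a proper function is finite, so
  there its differentiability is that of its real-valued version.\<close>

definition generator :: "('a::real_inner \<Rightarrow> ereal) \<Rightarrow> bool" where
  "generator \<Phi> \<longleftrightarrow>
    proper \<Phi> \<and> lower_semicont \<Phi> \<and> strictly_convex_on (eff_dom \<Phi>) \<Phi> \<and>
    interior (eff_dom \<Phi>) \<noteq> {} \<and>
    (\<forall>x\<in>interior (eff_dom \<Phi>). (\<lambda>y. real_of_ereal (\<Phi> y)) differentiable (at x))"

definition essentially_smooth :: "('a::real_inner \<Rightarrow> ereal) \<Rightarrow> bool" where
  "essentially_smooth \<Phi> \<longleftrightarrow>
    locally_bounded_on_dom (subdifferential \<Phi>) \<and> single_valued_on_dom (subdifferential \<Phi>)"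

definition essentially_strictly_convex :: "('a::real_inner \<Rightarrow> ereal) \<Rightarrow> bool" where
  "essentially_strictly_convex \<Phi> \<longleftrightarrow>
    locally_bounded_on_dom (set_valued_inverse (subdifferential \<Phi>)) \<and>
    (\<forall>C. convex C \<and> C \<subseteq> set_valued_dom (subdifferential \<Phi>) \<longrightarrow> strictly_convex_on C \<Phi>)"

definition legendre_generator :: "('a::real_inner \<Rightarrow> ereal) \<Rightarrow> bool" where
  "legendre_generator \<Phi> \<longleftrightarrow>
    generator \<Phi> \<and> essentially_smooth \<Phi> \<and> essentially_strictly_convex \<Phi>"

text \<open>The Riesz representer of the Frechet derivative.\<close>

definition frechet_gradient :: "('a::real_inner \<Rightarrow> real) \<Rightarrow> 'a \<Rightarrow> 'a" where
  "frechet_gradient F g = (THE v. \<forall>h. frechet_derivative F (at g) h = v \<bullet> h)"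

definition bregman :: "('a::real_inner \<Rightarrow> ereal) \<Rightarrow> 'a \<Rightarrow> 'a \<Rightarrow> real" where
  "bregman \<Phi> f g = real_of_ereal (\<Phi> f) - real_of_ereal (\<Phi> g)
    - frechet_gradient (\<lambda>x. real_of_ereal (\<Phi> x)) g \<bullet> (f - g)"

text \<open>Continuity of the second derivative \<open>D2\<close> is with respect to the operator norm.\<close>

definition twice_cont_frechet_diff_on ::
    "('a::real_normed_vector \<Rightarrow> real) \<Rightarrow> 'a set \<Rightarrow> bool" where
  "twice_cont_frechet_diff_on F A \<longleftrightarrow>
    (\<exists>(D1 :: 'a \<Rightarrow> 'a \<Rightarrow>\<^sub>L real) (D2 :: 'a \<Rightarrow> 'a \<Rightarrow>\<^sub>L 'a \<Rightarrow>\<^sub>L real).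
      (\<forall>x\<in>A. (F has_derivative blinfun_apply (D1 x)) (at x)) \<and>
      (\<forall>x\<in>A. (D1 has_derivative blinfun_apply (D2 x)) (at x)) \<and>
      continuous_on A D2)"

section \<open>Operators\<close>

definition self_adjoint :: "('a::real_inner \<Rightarrow> 'a) \<Rightarrow> bool" where
  "self_adjoint T \<longleftrightarrow> (\<forall>x y. T x \<bullet> y = x \<bullet> T y)"

definition strictly_positive :: "('a::real_inner \<Rightarrow> 'a) \<Rightarrow> bool" where
  "strictly_positive T \<longleftrightarrow> (\<forall>h. h \<noteq> 0 \<longrightarrow> 0 < h \<bullet> T h)"

end

theory Submission
  imports Defs
begin

text \<open>
  Write \<open>F\<close> for the real-valued version of \<open>\<Phi>\<close>. Symmetry of the divergence says
  \<open>2 (F f - F g) = (DF f + DF g) (f - g)\<close>. Differentiating in \<open>g\<close> in the direction \<open>h\<close> gives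
  \<open>DF f h = DF g h + D\<^sup>2F g h (f - g)\<close> for all \<open>f\<close>, so \<open>DF\<close> is affine in \<open>f\<close>. Differentiating once more
  at \<open>f = g\<close> shows that \<open>D\<^sup>2F g\<close> is symmetric, and inserting the affine expression into the first
  identity shows that \<open>F\<close> is quadratic. Strict convexity makes the quadratic form positive.
\<close>

text \<open>The representer is found as the minimiser of the energy
  \<open>J x = x \<bullet> x - 2 * L x\<close>. Completeness supplies the minimiser as the limit of
  a minimising sequence, and the first-order condition there is the claimed identity.\<close>

lemma riesz_representation_real:
  fixes L :: "'a::{real_inner, complete_space} \<Rightarrow> real"
  assumes "bounded_linear L"
  obtains v where "\<And>h. L h = v \<bullet> h"
proof -
  interpret L: bounded_linear L by fact
  obtain K where K: "\<And>x. norm (L x) \<le> norm x * K"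
    using L.bounded by blast
  define J where "J x = x \<bullet> x - 2 * L x" for x
  have J_lower: "- K\<^sup>2 \<le> J x" for x
  proof -
    have "0 \<le> (norm x - K)\<^sup>2" by simp
    moreover have "(norm x)\<^sup>2 = x \<bullet> x" by (rule power2_norm_eq_inner)
    moreover have "L x \<le> norm x * K" using K[of x] by simp
    ultimately show ?thesis by (simp add: J_def power2_diff)
  qed
  then have bdd: "bdd_below (range J)" by (intro bdd_belowI[of _ "- K\<^sup>2"]) auto
  define m where "m = Inf (range J)"
  have m_le: "m \<le> J x" for x
    unfolding m_def using bdd by (intro cInf_lower) auto
  have "\<exists>x. J x < m + 1 / real (Suc n)" for n
    using cInf_lessD[of "range J" "m + 1 / real (Suc n)"] by (auto simp: m_def)
  then obtain X where X: "\<And>n. J (X n) < m + 1 / real (Suc n)" by metis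
  \<comment> \<open>The linear part of \<open>J\<close> cancels against the midpoint term, leaving
    the parallelogram law. As \<open>J\<close> at the midpoint is at least \<open>m\<close>,
    near-minimisers are close together.\<close>
  have parallelogram: "(norm (x - y))\<^sup>2 = 2 * J x + 2 * J y - 4 * J ((1/2) *\<^sub>R (x + y))" for x y
    by (simp add: J_def power2_norm_eq_inner L.add L.scaleR inner_add inner_diff inner_commute)
       (simp add: field_simps)
  have close: "(norm (x - y))\<^sup>2 \<le> 4 * e" if "J x \<le> m + e" "J y \<le> m + e" for x y e
    using that m_le[of "(1/2) *\<^sub>R (x + y)"] unfolding parallelogram by linarith
  have "Cauchy X"
  proof (rule metric_CauchyI)
    fix e :: real assume "0 < e"
    \<comment> \<open>The factor 4 in \<open>close\<close> turns the threshold
      \<open>e\<^sup>2 / 4\<close> into a squared distance below \<open>e\<^sup>2\<close>.\<close>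
    then obtain N where N: "1 / real (Suc N) < e\<^sup>2 / 4"
      using nat_approx_posE[of "e\<^sup>2 / 4"] by auto
    have small: "J (X n) \<le> m + 1 / real (Suc N)" if "N \<le> n" for n
    proof -
      have "1 / real (Suc n) \<le> 1 / real (Suc N)" using that by (simp add: field_simps)
      then show ?thesis using X[of n] by linarith
    qed
    have "dist (X i) (X j) < e" if "N \<le> i" "N \<le> j" for i j
    proof -
      have "(norm (X i - X j))\<^sup>2 < e\<^sup>2"
        using close[OF small[OF that(1)] small[OF that(2)]] N by simp
      then show ?thesis using \<open>0 < e\<close> by (simp add: dist_norm power_less_imp_less_base)
    qed
    then show "\<exists>M. \<forall>i\<ge>M. \<forall>j\<ge>M. dist (X i) (X j) < e" by blast
  qed
  then obtain v where v: "X \<longlonglongrightarrow> v" using Cauchy_convergent convergent_def by blast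
  have "(\<lambda>n. J (X n)) \<longlonglongrightarrow> J v"
    unfolding J_def by (intro tendsto_intros v L.tendsto)
  moreover have "(\<lambda>n. m + 1 / real (Suc n)) \<longlonglongrightarrow> m"
    using tendsto_add[OF tendsto_const LIMSEQ_inverse_real_of_nat, of m] by (simp add: inverse_eq_divide)
  ultimately have "J v \<le> m"
    using X by (intro LIMSEQ_le[of "\<lambda>n. J (X n)" _ "\<lambda>n. m + 1 / real (Suc n)"]) (auto intro: less_imp_le)
  then have min: "J v \<le> J x" for x using m_le[of x] by linarith
  have "L h = v \<bullet> h" for h
  proof -
    have expand: "J (v + t *\<^sub>R h) = J v + 2 * t * (v \<bullet> h - L h) + t\<^sup>2 * (h \<bullet> h)" for t
      by (simp add: J_def L.add L.scaleR inner_add inner_commute power2_eq_square algebra_simps)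
    \<comment> \<open>Along each line through \<open>v\<close> the energy is a polynomial in
      \<open>t\<close> minimised at 0, so its linear coefficient vanishes.\<close>
    have "((\<lambda>t. J (v + t *\<^sub>R h)) has_real_derivative 2 * (v \<bullet> h - L h)) (at 0)"
      unfolding expand by (auto intro!: derivative_eq_intros)
    from DERIV_local_min[OF this, of 1] min show ?thesis by simp
  qed
  then show thesis by (rule that)
qed

lemma frechet_gradient_eqI:
  assumes "(F has_derivative (\<lambda>h. v \<bullet> h)) (at g)"
  shows "frechet_gradient F g = v"
proof -
  have D: "frechet_derivative F (at g) h = v \<bullet> h" for h
    by (simp flip: frechet_derivative_at[OF assms])
  show ?thesis
    unfolding frechet_gradient_def D
    by (rule the_equality) (simp_all add: vector_eq_rdot)
qed

text \<open>The definite description in \<open>frechet_gradient\<close> is meaningful only if a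
  representer exists; the Riesz theorem provides one.\<close>

lemma inner_frechet_gradient:
  fixes F :: "'a::{real_inner, complete_space} \<Rightarrow> real"
  assumes "(F has_derivative D) (at g)"
  shows "frechet_gradient F g \<bullet> h = D h"
proof -
  obtain v where v: "\<And>h. D h = v \<bullet> h"
    using riesz_representation_real has_derivative_bounded_linear[OF assms] by blast
  then have "D = (\<lambda>h. v \<bullet> h)" by auto
  with assms frechet_gradient_eqI v show ?thesis by metis
qed

text \<open>\<open>T h\<close> is the Riesz representer of \<open>B h\<close>. Uniqueness of
  representers makes \<open>T\<close> linear, and testing \<open>B h\<close> on \<open>T h\<close>
  itself bounds \<open>T\<close> by the norm of \<open>B\<close>.\<close>

lemma self_adjoint_operator_of_form:
  fixes B :: "'a::{real_inner, complete_space} \<Rightarrow>\<^sub>L 'a \<Rightarrow>\<^sub>L real"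
  assumes sym: "\<And>h k. B h k = B k h"
  obtains T where "bounded_linear T" "self_adjoint T" "\<And>h k. B h k = T h \<bullet> k"
proof -
  have "\<exists>v. \<forall>k. B h k = v \<bullet> k" for h
    using riesz_representation_real[OF blinfun.bounded_linear_right[of "B h"]] by metis
  then obtain T where T: "\<And>h k. B h k = T h \<bullet> k" by metis
  have eqI: "x = y" if "\<And>k. x \<bullet> k = y \<bullet> k" for x y :: 'a
    using that vector_eq_rdot by blast
  have "norm (T h) \<le> norm h * norm B" for h
  proof (cases "T h = 0")
    case False
    have "norm (T h) * norm (T h) = B h (T h)"
      by (simp add: T norm_eq_sqrt_inner)
    also have "\<dots> \<le> norm (B h) * norm (T h)"
      using norm_blinfun[of "B h" "T h"] by simp
    also have "\<dots> \<le> norm B * norm h * norm (T h)"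
      by (intro mult_right_mono norm_blinfun) simp
    finally show ?thesis using False by (simp add: mult.commute)
  qed simp
  moreover have "T (h + k) = T h + T k" for h k
    by (rule eqI) (simp add: inner_add blinfun.add_left blinfun.add_right flip: T)
  moreover have "T (r *\<^sub>R h) = r *\<^sub>R T h" for r h
    by (rule eqI) (simp add: blinfun.scaleR_left blinfun.scaleR_right flip: T)
  ultimately have "bounded_linear T" by (intro bounded_linear_intro)
  moreover have "self_adjoint T"
    unfolding self_adjoint_def using sym T by (metis inner_commute)
  ultimately show thesis using T by (rule that)
qed

lemma quadratic_has_derivative:
  fixes T :: "'a::real_inner \<Rightarrow> 'a"
  assumes "bounded_linear T" "self_adjoint T"
  shows "((\<lambda>f. 1 / 2 * (f \<bullet> T f) + b \<bullet> f + c) has_derivative (\<lambda>h. (T g + b) \<bullet> h)) (at g)"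
proof -
  interpret bounded_linear T by fact
  have "h \<bullet> T g = T g \<bullet> h" "g \<bullet> T h = T g \<bullet> h" for h
    using assms(2) by (simp_all add: self_adjoint_def inner_commute)
  then show ?thesis
    by (auto intro!: derivative_eq_intros has_derivative simp: inner_add_left)
qed

text \<open>The gradient at \<open>g\<close> is \<open>T g + b\<close>, so the contributions of
  \<open>b\<close> and \<open>c\<close> cancel; self-adjointness merges the cross terms into the
  form at \<open>f - g\<close>.\<close>

lemma bregman_quadratic:
  fixes \<Phi> :: "'a::real_inner \<Rightarrow> ereal"
  assumes T: "bounded_linear T" "self_adjoint T" and "open A"
    and \<Phi>: "\<And>f. f \<in> A \<Longrightarrow> \<Phi> f = ereal (1 / 2 * (f \<bullet> T f) + b \<bullet> f + c)"
    and fg: "f \<in> A" "g \<in> A"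
  shows "bregman \<Phi> f g = 1 / 2 * ((f - g) \<bullet> T (f - g))"
proof -
  interpret bounded_linear T by fact
  have "((\<lambda>x. real_of_ereal (\<Phi> x)) has_derivative (\<lambda>h. (T g + b) \<bullet> h)) (at g)"
    using quadratic_has_derivative[OF T] \<open>open A\<close> fg(2)
    by (rule has_derivative_transform_within_open) (simp add: \<Phi>)
  then have "frechet_gradient (\<lambda>x. real_of_ereal (\<Phi> x)) g = T g + b"
    by (rule frechet_gradient_eqI)
  moreover have "f \<bullet> T g = T g \<bullet> f" "g \<bullet> T f = T g \<bullet> f" "g \<bullet> T g = T g \<bullet> g"
    using T(2) by (simp_all add: self_adjoint_def inner_commute)
  ultimately show ?thesis
    by (simp add: bregman_def \<Phi> fg diff inner_add_left inner_diff_left inner_diff_right field_simps)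
qed

text \<open>All differentiation takes place at the one base point \<open>g\<close>, so
  \<open>D2\<close> is a fixed bilinear form. Hypothesis \<open>sym\<close> is the symmetry of the
  divergence, rearranged.\<close>

lemma symmetric_bregman_quadratic:
  fixes F :: "'a::{real_inner, complete_space} \<Rightarrow> real"
    and D1 :: "'a \<Rightarrow> 'a \<Rightarrow>\<^sub>L real" and D2 :: "'a \<Rightarrow>\<^sub>L 'a \<Rightarrow>\<^sub>L real"
  assumes "open A" "g \<in> A"
    and D1: "\<And>x. x \<in> A \<Longrightarrow> (F has_derivative D1 x) (at x)"
    and D2: "(D1 has_derivative D2) (at g)"
    and sym: "\<And>f g. \<lbrakk>f \<in> A; g \<in> A\<rbrakk> \<Longrightarrow> 2 * (F f - F g) = D1 f (f - g) + D1 g (f - g)"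
  obtains T b c where "bounded_linear T" "self_adjoint T"
    "\<And>f. f \<in> A \<Longrightarrow> F f = 1 / 2 * (f \<bullet> T f) + b \<bullet> f + c"
proof -
  have affine: "D1 f h = D1 g h + D2 h (f - g)" if "f \<in> A" for f h
  proof -
    \<comment> \<open>By \<open>sym\<close> this function of \<open>x\<close> vanishes on
      \<open>A\<close>, so its derivative at \<open>g\<close>, computed by the product rule, is
      zero.\<close>
    have "((\<lambda>x. 2 * (F x - F f) - D1 x (x - f) - D1 f (x - f)) has_derivative
        (\<lambda>h. 2 * D1 g h - (D2 h (g - f) + D1 g h) - D1 f h)) (at g)"
      by (rule derivative_eq_intros D1 D2 \<open>g \<in> A\<close> refl
            bounded_linear.has_derivative[OF blinfun.bounded_linear_right] | simp add: add.commute)+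
    moreover have "((\<lambda>x. 2 * (F x - F f) - D1 x (x - f) - D1 f (x - f)) has_derivative (\<lambda>h. 0)) (at g)"
      by (rule has_derivative_transform_within_open[OF has_derivative_const[of 0] assms(1,2)])
         (simp add: sym[OF _ that] del: right_diff_distrib_numeral)
    ultimately have "(\<lambda>h. 2 * D1 g h - (D2 h (g - f) + D1 g h) - D1 f h) = (\<lambda>h. 0)"
      by (rule has_derivative_unique)
    from fun_cong[OF this, of h] show ?thesis by (simp add: blinfun.diff_right)
  qed
  \<comment> \<open>In \<open>affine\<close> the point \<open>f\<close> enters through the second
    argument of \<open>D2\<close>, whereas differentiating \<open>D1\<close> puts the increment into
    the first. Comparing the two derivatives swaps the arguments.\<close>
  have D2_sym: "D2 h k = D2 k h" for h k
  proof -
    have "((\<lambda>f. D1 f k) has_derivative (\<lambda>h. D2 h k)) (at g)"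
      by (rule bounded_linear.has_derivative[OF blinfun.bounded_linear_left D2])
    moreover have "((\<lambda>f. D1 g k + D2 k (f - g)) has_derivative (\<lambda>h. D2 k h)) (at g)"
      by (rule derivative_eq_intros refl
            bounded_linear.has_derivative[OF blinfun.bounded_linear_right] | simp)+
    then have "((\<lambda>f. D1 f k) has_derivative (\<lambda>h. D2 k h)) (at g)"
      by (rule has_derivative_transform_within_open[OF _ assms(1,2)]) (simp add: affine)
    ultimately have "(\<lambda>h. D2 h k) = (\<lambda>h. D2 k h)" by (rule has_derivative_unique)
    then show ?thesis by (rule fun_cong)
  qed
  obtain T where T: "bounded_linear T" "self_adjoint T" "\<And>h k. D2 h k = T h \<bullet> k"
    using self_adjoint_operator_of_form[OF D2_sym] by blast
  interpret bounded_linear T by fact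
  obtain v where v: "\<And>h. D1 g h = v \<bullet> h"
    using riesz_representation_real blinfun.bounded_linear_right by blast
  \<comment> \<open>This is the second-order Taylor polynomial at \<open>g\<close>, with gradient
    \<open>v\<close> and Hessian \<open>T\<close>, expanded about the origin.\<close>
  have "F f = 1 / 2 * (f \<bullet> T f) + (v - T g) \<bullet> f + (F g - v \<bullet> g + 1 / 2 * (g \<bullet> T g))"
    if "f \<in> A" for f
  proof -
    have "T f \<bullet> g = T g \<bullet> f" "f \<bullet> T f = T f \<bullet> f" "g \<bullet> T g = T g \<bullet> g"
      using T(2) by (simp_all add: self_adjoint_def inner_commute)
    moreover have "2 * (F f - F g) = 2 * (v \<bullet> (f - g)) + T (f - g) \<bullet> (f - g)"
      using sym[OF that \<open>g \<in> A\<close>] affine[OF that, of "f - g"] by (simp add: v T(3))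
    ultimately show ?thesis
      by (simp add: diff inner_diff_left inner_diff_right field_simps)
  qed
  with T show thesis by (intro that)
qed

text \<open>Strict convexity at the midpoint \<open>g\<close> of \<open>g - k\<close> and
  \<open>g + k\<close> leaves half of \<open>k \<bullet> T k\<close> as a positive gap, since affine
  and cross terms cancel.\<close>

lemma strictly_positive_of_strictly_convex:
  fixes \<Phi> :: "'a::real_inner \<Rightarrow> ereal"
  assumes "bounded_linear T" "open A" "g \<in> A"
    and convex: "strictly_convex_on A \<Phi>"
    and \<Phi>: "\<And>f. f \<in> A \<Longrightarrow> \<Phi> f = ereal (1 / 2 * (f \<bullet> T f) + b \<bullet> f + c)"
  shows "strictly_positive T"
  unfolding strictly_positive_def
proof (intro allI impI)
  interpret bounded_linear T by fact
  fix h :: 'a assume "h \<noteq> 0"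
  obtain e where e: "0 < e" "ball g e \<subseteq> A"
    using \<open>open A\<close> \<open>g \<in> A\<close> open_contains_ball by blast
  \<comment> \<open>Rescaling \<open>h\<close> to norm \<open>e / 2\<close> keeps both endpoints in
    the ball and preserves the sign of the form.\<close>
  define k where "k = (e / (2 * norm h)) *\<^sub>R h"
  have "k \<noteq> 0" using \<open>0 < e\<close> \<open>h \<noteq> 0\<close> by (simp add: k_def)
  have "norm k < e" using \<open>0 < e\<close> \<open>h \<noteq> 0\<close> by (simp add: k_def)
  then have A: "g - k \<in> A" "g + k \<in> A" using e(2) by (auto simp: subset_iff dist_norm)
  have "g - k \<noteq> g + k"
  proof
    assume "g - k = g + k"
    then have "2 *\<^sub>R k = 0" by (simp add: scaleR_2 algebra_simps)
    with \<open>k \<noteq> 0\<close> show False by simp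
  qed
  moreover have "(1 - 1/2) *\<^sub>R (g - k) + (1/2) *\<^sub>R (g + k) = g"
    by (simp add: scaleR_diff_right scaleR_add_right flip: scaleR_add_left)
  ultimately have "\<Phi> g < ereal (1 - 1/2) * \<Phi> (g - k) + ereal (1/2) * \<Phi> (g + k)"
    using convex[unfolded strictly_convex_on_def, rule_format, OF A, of "1/2"] by simp
  then have "0 < k \<bullet> T k"
    by (simp add: \<Phi> A \<open>g \<in> A\<close> diff add inner_add_left inner_add_right inner_diff_left inner_diff_right)
       (simp add: field_simps)
  also have "k \<bullet> T k = (e / (2 * norm h))\<^sup>2 * (h \<bullet> T h)"
    by (simp add: k_def scaleR power2_eq_square)
  finally show "0 < h \<bullet> T h" by (simp add: zero_less_mult_iff)
qed

lemma strictly_convex_on_subset: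
  "\<lbrakk>strictly_convex_on C \<Phi>; B \<subseteq> C\<rbrakk> \<Longrightarrow> strictly_convex_on B \<Phi>"
  unfolding strictly_convex_on_def by blast

theorem theorem12:
  fixes \<Phi> :: "'a::{real_inner, complete_space} \<Rightarrow> ereal"
    and A :: "'a set"
  defines "A \<equiv> interior (eff_dom \<Phi>)"
  assumes "legendre_generator \<Phi>"
    and "twice_cont_frechet_diff_on (\<lambda>x. real_of_ereal (\<Phi> x)) A"
  shows "((\<forall>f\<in>A. \<forall>g\<in>A. bregman \<Phi> f g = bregman \<Phi> g f) \<longleftrightarrow>
          (\<exists>(T :: 'a \<Rightarrow> 'a) (b :: 'a) (c :: real).
             bounded_linear T \<and> self_adjoint T \<and> strictly_positive T \<and>
             (\<forall>f\<in>A. \<Phi> f = ereal (1 / 2 * (f \<bullet> T f) + b \<bullet> f + c))))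
       \<and> ((\<exists>(T :: 'a \<Rightarrow> 'a) (b :: 'a) (c :: real).
             bounded_linear T \<and> self_adjoint T \<and> strictly_positive T \<and>
             (\<forall>f\<in>A. \<Phi> f = ereal (1 / 2 * (f \<bullet> T f) + b \<bullet> f + c))) \<longleftrightarrow>
          (\<exists>T :: 'a \<Rightarrow> 'a.
             bounded_linear T \<and> self_adjoint T \<and> strictly_positive T \<and>
             (\<forall>f\<in>A. \<forall>g\<in>A. bregman \<Phi> f g = 1 / 2 * ((f - g) \<bullet> T (f - g)))))"
    (is "(?symmetric \<longleftrightarrow> ?quadratic) \<and> (?quadratic \<longleftrightarrow> ?quadratic_divergence)")
proof -
  define F where "F x = real_of_ereal (\<Phi> x)" for x
  have "open A" by (simp add: A_def)
  have "generator \<Phi>" using assms(2) by (simp add: legendre_generator_def)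
  then have "A \<noteq> {}" and convex: "strictly_convex_on A \<Phi>"
    by (auto simp: generator_def A_def intro: strictly_convex_on_subset[OF _ interior_subset])
  \<comment> \<open>\<open>real_of_ereal\<close> sends infinite values to 0, so recovering
    \<open>\<Phi>\<close> from \<open>F\<close> needs finiteness: the effective domain excludes
    \<infinity>, properness the other infinity.\<close>
  have \<Phi>_eq: "\<Phi> x = ereal (F x)" if "x \<in> A" for x
    using \<open>generator \<Phi>\<close> subsetD[OF interior_subset, of x "eff_dom \<Phi>"] that
    by (cases "\<Phi> x") (auto simp: F_def A_def generator_def proper_def eff_dom_def)
  have "?quadratic" if ?symmetric
  proof -
    obtain g where "g \<in> A" using \<open>A \<noteq> {}\<close> by blast
    obtain D1 :: "'a \<Rightarrow> 'a \<Rightarrow>\<^sub>L real" and D2 :: "'a \<Rightarrow> 'a \<Rightarrow>\<^sub>L 'a \<Rightarrow>\<^sub>L real"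
      where D1: "\<And>x. x \<in> A \<Longrightarrow> (F has_derivative D1 x) (at x)"
        and D2: "\<And>x. x \<in> A \<Longrightarrow> (D1 has_derivative D2 x) (at x)"
      using assms(3) unfolding twice_cont_frechet_diff_on_def F_def by blast
    have bregman: "bregman \<Phi> f g = F f - F g - D1 g (f - g)" if "g \<in> A" for f g
      using inner_frechet_gradient[OF D1[OF that]] by (simp add: bregman_def F_def[abs_def])
    have "2 * (F f - F g) = D1 f (f - g) + D1 g (f - g)" if "f \<in> A" "g \<in> A" for f g
      using \<open>?symmetric\<close> that by (force simp: bregman blinfun.diff_right)
    then obtain T b c where T: "bounded_linear T" "self_adjoint T"
      and F: "\<And>f. f \<in> A \<Longrightarrow> F f = 1 / 2 * (f \<bullet> T f) + b \<bullet> f + c"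
      using symmetric_bregman_quadratic[OF \<open>open A\<close> \<open>g \<in> A\<close> D1 D2[OF \<open>g \<in> A\<close>]] by blast
    have "\<Phi> f = ereal (1 / 2 * (f \<bullet> T f) + b \<bullet> f + c)" if "f \<in> A" for f
      using \<Phi>_eq[OF that] F[OF that] by simp
    then show ?thesis
      using T strictly_positive_of_strictly_convex[OF T(1) \<open>open A\<close> \<open>g \<in> A\<close> convex] by blast
  qed
  moreover have ?quadratic_divergence if ?quadratic
    using that bregman_quadratic[OF _ _ \<open>open A\<close>] by blast
  moreover have ?symmetric if ?quadratic_divergence
  proof (intro ballI)
    fix f g assume "f \<in> A" "g \<in> A"
    obtain T where "bounded_linear T"
      and d: "\<forall>f\<in>A. \<forall>g\<in>A. bregman \<Phi> f g = 1 / 2 * ((f - g) \<bullet> T (f - g))"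
      using \<open>?quadratic_divergence\<close> by blast
    then interpret bounded_linear T by simp
    \<comment> \<open>A quadratic form is even; this closes the cycle of implications.\<close>
    have "(f - g) \<bullet> T (f - g) = (g - f) \<bullet> T (g - f)"
      by (simp add: diff inner_diff_left inner_diff_right)
    with d \<open>f \<in> A\<close> \<open>g \<in> A\<close> show "bregman \<Phi> f g = bregman \<Phi> g f" by metis
  qed
  ultimately show ?thesis by blast
qed

end
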